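(* Let $\mathbf{X}$ be a completely regular Hausdorff topological space, $\varrho:\mathbf{X}\to(0,\infty)$ an admissible weight function, and $(P_t)_{t\ge0}$ a generalised Feller semigroup on $\mathcal{B}^\varrho(\mathbf{X})$. Suppose that there exist $\gamma\in\mathcal{P}(\mathbf{X})$ and a strictly positive sequence $(T_n)$ with $T_n\to+\infty$ as $n\to+\infty$ such that (i) the sequence of measures $Q^\ast_{T_n}\gamma:=\frac{1}{T_n}\int_0^{T_n}P_t^\ast\gamma\,\mathrm{d}t$ converges weakly to some $\mu\in\mathcal{P}(\mathbf{X})$; (ii) $\displaystyle\sup_{t\ge0}\int_{\mathbf{X}}P_t\varrho(\lambda)\,\gamma(\mathrm{d}\lambda)<\infty.$ Then $\mu$ is an invariant measure for $(P_t)_{t\ge0}$, i.e. $\langle P_t\varphi,\mu\rangle=\langle\varphi,\mu\rangle$ for all $t\ge0$ and all $\varphi\in\mathcal{B}^\varrho(\mathbf{X})$.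
   Context: A function $\varrho:\mathbf{X}\to(0,\infty)$ is an admissible weight function if $K_R=\{x\in\mathbf{X}:\varrho(x)\le R\}$ is compact for all $R>0$. $\mathrm{B}^\varrho(\mathbf{X})$ is the Banach space of functions $f:\mathbf{X}\to\mathbb{R}$ with $\|f\|_\varrho=\sup_{x\in\mathbf{X}}\varrho(x)^{-1}|f(x)|<\infty$, and $\mathcal{B}^\varrho(\mathbf{X})$ is the closure in $\mathrm{B}^\varrho(\mathbf{X})$ of the bounded continuous functions $\mathcal{C}_b(\mathbf{X})$. A generalised Feller semigroup is a family of bounded linear operators $P_t:\mathcal{B}^\varrho(\mathbf{X})\to\mathcal{B}^\varrho(\mathbf{X})$, $t\ge0$, such that (i) $P_0=I$; (ii) $P_{t+s}=P_tP_s$ for all $t,s\ge0$; (iii) $\lim_{t\downarrow0}P_tf(x)=f(x)$ for all $f\in\mathcal{B}^\varrho(\mathbf{X})$ and $x\in\mathbf{X}$; (iv) there exist $C>0$ and $\varepsilon>0$ with $\|P_t\|_{L(\mathcal{B}^\varrho(\mathbf{X}))}\le C$ for all $t\in[0,\varepsilon]$; (v) $P_tf\ge0$ for every $f\in\mathcal{B}^\varrho(\mathbf{X})$ with $f\ge0$. $\mathcal{P}(\mathbf{X})$ is the set of probability measures on $\mathbf{X}$; $\langle\varphi,\mu\rangle=\int_{\mathbf{X}}\varphi\,\mathrm{d}\mu$. The adjoint $P_t^\ast$ is defined by $\langle P_t\varphi,\mu\rangle=\langle\varphi,P_t^\ast\mu\rangle$ for $\varphi\in\mathcal{B}^\varrho(\mathbf{X})$,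 $\mu\in\mathcal{P}(\mathbf{X})$. The semigroup is taken together with its associated Markov process $(\lambda_t)_{t\ge0}$ in $\mathbf{X}$: $P_t\varphi(\lambda_0)=\mathbb{E}_{\lambda_0}[\varphi(\lambda_t)]$, and $P_t^\ast\gamma\in\mathcal{P}(\mathbf{X})$ is the law of $\lambda_t$ when $\lambda_0$ has law $\gamma$. The quantity $P_t\varrho(\lambda)$ means $\mathbb{E}_\lambda[\varrho(\lambda_t)]$. *)

theory Defs
  imports "HOL-Probability.Probability"
begin

definition admissible_weight :: "('a::topological_space \<Rightarrow> real) \<Rightarrow> bool" where
  "admissible_weight \<rho> \<longleftrightarrow> (\<forall>x. 0 < \<rho> x) \<and> (\<forall>R>0. compact {x. \<rho> x \<le> R})"

definition B_space :: "('a \<Rightarrow> real) \<Rightarrow> ('a \<Rightarrow> real) set" where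
  "B_space \<rho> = {f. bdd_above (range (\<lambda>x. inverse (\<rho> x) * \<bar>f x\<bar>))}"

text \<open>Only meaningful on \<^const>\<open>B_space\<close>; elsewhere the supremum is unspecified.\<close>

definition wnorm :: "('a \<Rightarrow> real) \<Rightarrow> ('a \<Rightarrow> real) \<Rightarrow> real" where
  "wnorm \<rho> f = (SUP x. inverse (\<rho> x) * \<bar>f x\<bar>)"

text \<open>The norm closure of the bounded continuous functions, which lie in \<^const>\<open>B_space\<close>
  by lemma \<open>bcontfun_subset_B_space\<close> below.\<close>

definition calB :: "('a::topological_space \<Rightarrow> real) \<Rightarrow> ('a \<Rightarrow> real) set" where
  "calB \<rho> = {f \<in> B_space \<rho>. \<forall>e>0. \<exists>g\<in>bcontfun. wnorm \<rho> (\<lambda>x. f x - g x) < e}"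

text \<open>As for \<^const>\<open>onorm\<close>, the quotient is 0 at the zero function.\<close>

definition opnorm :: "('a::topological_space \<Rightarrow> real) \<Rightarrow> (('a \<Rightarrow> real) \<Rightarrow> ('a \<Rightarrow> real)) \<Rightarrow> real" where
  "opnorm \<rho> T = (SUP f\<in>calB \<rho>. wnorm \<rho> (T f) / wnorm \<rho> f)"

definition bounded_operator ::
    "('a::topological_space \<Rightarrow> real) \<Rightarrow> (('a \<Rightarrow> real) \<Rightarrow> ('a \<Rightarrow> real)) \<Rightarrow> bool" where
  "bounded_operator \<rho> T \<longleftrightarrow>
     (\<forall>f\<in>calB \<rho>. T f \<in> calB \<rho>) \<and>
     (\<forall>f\<in>calB \<rho>. \<forall>g\<in>calB \<rho>. T (\<lambda>x. f x + g x) = (\<lambda>x. T f x + T g x)) \<and>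
     (\<forall>c. \<forall>f\<in>calB \<rho>. T (\<lambda>x. c * f x) = (\<lambda>x. c * T f x)) \<and>
     (\<exists>C. \<forall>f\<in>calB \<rho>. wnorm \<rho> (T f) \<le> C * wnorm \<rho> f)"

locale generalised_Feller_semigroup =
  fixes \<rho> :: "'a::topological_space \<Rightarrow> real"
    and P :: "real \<Rightarrow> ('a \<Rightarrow> real) \<Rightarrow> ('a \<Rightarrow> real)"
  assumes bounded_operator: "\<And>t. 0 \<le> t \<Longrightarrow> bounded_operator \<rho> (P t)"
    and P_0: "\<And>f. f \<in> calB \<rho> \<Longrightarrow> P 0 f = f"
    and P_add: "\<And>s t f. 0 \<le> s \<Longrightarrow> 0 \<le> t \<Longrightarrow> f \<in> calB \<rho> \<Longrightarrow> P (t + s) f = P t (P s f)"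
    and pointwise_limit: "\<And>f x. f \<in> calB \<rho> \<Longrightarrow> ((\<lambda>t. P t f x) \<longlongrightarrow> f x) (at_right 0)"
    and locally_bounded: "\<exists>C>0. \<exists>\<epsilon>>0. \<forall>t\<in>{0..\<epsilon>}. opnorm \<rho> (P t) \<le> C"
    and positive: "\<And>t f x. 0 \<le> t \<Longrightarrow> f \<in> calB \<rho> \<Longrightarrow> (\<And>y. 0 \<le> f y) \<Longrightarrow> 0 \<le> P t f x"

text \<open>A Markov process \<open>\<lambda>\<close> on the measurable space \<open>\<Omega>\<close>, adapted to the filtration \<open>F\<close>, with one law
  \<open>Pr x\<close> for each starting point \<open>x\<close>. Times are real numbers, and only those in \<open>[0, \<infinity>)\<close> matter.
  All expectations of functions in \<^const>\<open>calB\<close> are required to exist, because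
  \<^const>\<open>lebesgue_integral\<close> is 0 on nonintegrable functions.\<close>

locale associated_Markov_process =
  fixes \<rho> :: "'a::t2_space \<Rightarrow> real"
    and P :: "real \<Rightarrow> ('a \<Rightarrow> real) \<Rightarrow> ('a \<Rightarrow> real)"
    and \<Omega> :: "'w measure"
    and F :: "real \<Rightarrow> 'w measure"
    and Pr :: "'a \<Rightarrow> 'w measure"
    and \<Lambda> :: "real \<Rightarrow> 'w \<Rightarrow> 'a"
  assumes filtration: "filtration (space \<Omega>) F"
    and subalgebra: "\<And>t. 0 \<le> t \<Longrightarrow> subalgebra \<Omega> (F t)"
    and prob_space: "\<And>x. prob_space (Pr x)"
    and sets_Pr: "\<And>x. sets (Pr x) = sets \<Omega>"
    and adapted: "\<And>t. 0 \<le> t \<Longrightarrow> \<Lambda> t \<in> F t \<rightarrow>\<^sub>M borel"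
    and start: "\<And>x. AE \<omega> in Pr x. \<Lambda> 0 \<omega> = x"
    and kernel: "\<And>t. 0 \<le> t \<Longrightarrow> (\<lambda>x. distr (Pr x) borel (\<Lambda> t)) \<in> borel \<rightarrow>\<^sub>M prob_algebra borel"
    and integrable: "\<And>t \<phi> x. 0 \<le> t \<Longrightarrow> \<phi> \<in> calB \<rho> \<Longrightarrow> integrable (Pr x) (\<lambda>\<omega>. \<phi> (\<Lambda> t \<omega>))"
    and expectation: "\<And>t \<phi> x. 0 \<le> t \<Longrightarrow> \<phi> \<in> calB \<rho> \<Longrightarrow> P t \<phi> x = (\<integral>\<omega>. \<phi> (\<Lambda> t \<omega>) \<partial>Pr x)"
    and Markov: "\<And>s t \<phi> x. 0 \<le> s \<Longrightarrow> 0 \<le> t \<Longrightarrow> \<phi> \<in> calB \<rho> \<Longrightarrow>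
      AE \<omega> in Pr x. real_cond_exp (Pr x) (F s) (\<lambda>\<omega>. \<phi> (\<Lambda> (s + t) \<omega>)) \<omega> = P t \<phi> (\<Lambda> s \<omega>)"

text \<open>The law of \<open>\<Lambda> t\<close> when the initial law is \<open>\<gamma>\<close>; lemma \<open>adjoint_duality\<close> below is the defining
  relation of an adjoint.\<close>

definition adjoint_semigroup ::
    "('a::topological_space \<Rightarrow> 'w measure) \<Rightarrow> (real \<Rightarrow> 'w \<Rightarrow> 'a) \<Rightarrow> real \<Rightarrow> 'a measure \<Rightarrow> 'a measure" where
  "adjoint_semigroup Pr \<Lambda> t \<gamma> = \<gamma> \<bind> (\<lambda>x. distr (Pr x) borel (\<Lambda> t))"

text \<open>The measure \<open>A \<mapsto> (1/T) \<integral>\<^sub>0\<^sup>T \<nu> t A dt\<close> on Borel sets. If this set function is not countably additive,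
  then \<^const>\<open>measure_of\<close> returns the null measure.\<close>

definition time_average :: "(real \<Rightarrow> 'a::topological_space measure) \<Rightarrow> real \<Rightarrow> 'a measure" where
  "time_average \<nu> T = measure_of UNIV (sets borel)
     (\<lambda>A. ennreal (1 / T) * (\<integral>\<^sup>+t\<in>{0..T}. emeasure (\<nu> t) A \<partial>lborel))"

definition weakly_converges :: "(nat \<Rightarrow> 'a::topological_space measure) \<Rightarrow> 'a measure \<Rightarrow> bool" where
  "weakly_converges M \<mu> \<longleftrightarrow>
     (\<forall>f\<in>bcontfun. (\<lambda>n. \<integral>x. f x \<partial>M n) \<longlonglongrightarrow> (\<integral>x. (f x :: real) \<partial>\<mu>))"

text \<open>The first conjunct says that the pairings with \<open>\<mu>\<close> exist. It also covers \<open>P t \<phi>\<close>, which is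
  again in \<^const>\<open>calB\<close>.\<close>

definition invariant_measure ::
    "('a::topological_space \<Rightarrow> real) \<Rightarrow> (real \<Rightarrow> ('a \<Rightarrow> real) \<Rightarrow> ('a \<Rightarrow> real)) \<Rightarrow> 'a measure \<Rightarrow> bool" where
  "invariant_measure \<rho> P \<mu> \<longleftrightarrow>
     (\<forall>\<phi>\<in>calB \<rho>. integrable \<mu> \<phi>) \<and>
     (\<forall>t\<ge>0. \<forall>\<phi>\<in>calB \<rho>. (\<integral>x. P t \<phi> x \<partial>\<mu>) = (\<integral>x. \<phi> x \<partial>\<mu>))"

lemma admissible_weight_bounded_below:
  fixes \<rho> :: "'a::t2_space \<Rightarrow> real"
  assumes "admissible_weight \<rho>"
  obtains c where "0 < c" "\<And>x. c \<le> \<rho> x"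
proof (rule ccontr)
  assume "\<not> thesis"
  with that have small: "\<And>c. 0 < c \<Longrightarrow> \<exists>x. \<rho> x < c" by (meson not_le)
  have pos: "\<And>x. 0 < \<rho> x" and cpt: "\<And>R. 0 < R \<Longrightarrow> compact {x. \<rho> x \<le> R}"
    using assms by (auto simp: admissible_weight_def)
  define K where "K = (\<lambda>R. {x. \<rho> x \<le> R})"
  have "K 1 \<inter> \<Inter>(K ` {0<..}) \<noteq> {}"
  proof (rule compact_imp_fip)
    show "compact (K 1)" by (simp add: K_def cpt)
    show "closed T" if "T \<in> K ` {0<..}" for T
      using that cpt by (auto simp: K_def intro!: compact_imp_closed)
    fix G assume G: "finite G" "G \<subseteq> K ` {0<..}"
    then obtain I where I: "I \<subseteq> {0<..}" "finite I" "G = K ` I"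
      by (meson finite_subset_image)
    define m where "m = Min (insert 1 I)"
    have "0 < m" using I by (auto simp: m_def)
    then obtain x where "\<rho> x < m" using small by blast
    moreover have "m \<le> R" if "R \<in> insert 1 I" for R using I that by (auto simp: m_def)
    ultimately have "x \<in> K R" if "R \<in> insert 1 I" for R using that by (force simp: K_def)
    then show "K 1 \<inter> \<Inter>G \<noteq> {}" using I by auto
  qed
  then obtain x where "\<And>R. 0 < R \<Longrightarrow> \<rho> x \<le> R" by (auto simp: K_def)
  from this[of "\<rho> x / 2"] pos[of x] show False by simp
qed

lemma bcontfun_subset_B_space:
  fixes \<rho> :: "'a::t2_space \<Rightarrow> real"
  assumes "admissible_weight \<rho>"
  shows "bcontfun \<subseteq> B_space \<rho>"
proof
  fix g :: "'a \<Rightarrow> real" assume "g \<in> bcontfun"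
  then obtain b where b: "\<And>x. \<bar>g x\<bar> \<le> b"
    by (auto simp: bcontfun_def bounded_iff)
  obtain c where c: "0 < c" "\<And>x. c \<le> \<rho> x"
    using admissible_weight_bounded_below[OF assms] by blast
  have "inverse (\<rho> x) * \<bar>g x\<bar> \<le> inverse c * b" for x
    using b[of x] c by (intro mult_mono le_imp_inverse_le) auto
  then show "g \<in> B_space \<rho>" by (auto simp: B_space_def bdd_above_def)
qed

lemma borel_measurable_calB:
  fixes \<rho> :: "'a::t2_space \<Rightarrow> real"
  assumes \<rho>: "admissible_weight \<rho>" and f: "f \<in> calB \<rho>"
  shows "f \<in> borel_measurable borel"
proof -
  have pos: "\<And>x. 0 < \<rho> x" using \<rho> by (auto simp: admissible_weight_def)
  have "\<exists>g. \<forall>n. g n \<in> bcontfun \<and> wnorm \<rho> (\<lambda>x. f x - g n x) < inverse (real (Suc n))"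
  proof (intro choice allI)
    fix n :: nat
    have "0 < inverse (real (Suc n))" by simp
    then show "\<exists>g. g \<in> bcontfun \<and> wnorm \<rho> (\<lambda>x. f x - g x) < inverse (real (Suc n))"
      using f unfolding calB_def by blast
  qed
  then obtain g where g: "\<And>n. g n \<in> bcontfun"
    and lt: "\<And>n. wnorm \<rho> (\<lambda>x. f x - g n x) < inverse (real (Suc n))" by blast
  have le: "\<bar>f x - g n x\<bar> \<le> \<rho> x * inverse (real (Suc n))" for n x
  proof -
    have "f \<in> B_space \<rho>" "g n \<in> B_space \<rho>"
      using f g bcontfun_subset_B_space[OF \<rho>] by (auto simp: calB_def)
    then obtain a b where ab: "\<And>x. inverse (\<rho> x) * \<bar>f x\<bar> \<le> a" "\<And>x. inverse (\<rho> x) * \<bar>g n x\<bar> \<le> b"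
      by (auto simp: B_space_def bdd_above_def)
    have "inverse (\<rho> x) * \<bar>f x - g n x\<bar> \<le> a + b" for x
    proof -
      have "inverse (\<rho> x) * \<bar>f x - g n x\<bar> \<le> inverse (\<rho> x) * (\<bar>f x\<bar> + \<bar>g n x\<bar>)"
        using pos[of x] by (intro mult_left_mono) auto
      also have "\<dots> \<le> a + b" using ab[of x] by (simp add: distrib_left)
      finally show ?thesis .
    qed
    then have "bdd_above (range (\<lambda>x. inverse (\<rho> x) * \<bar>f x - g n x\<bar>))"
      by (auto simp: bdd_above_def)
    then have "inverse (\<rho> x) * \<bar>f x - g n x\<bar> \<le> wnorm \<rho> (\<lambda>x. f x - g n x)"
      unfolding wnorm_def by (intro cSUP_upper) auto
    also have "\<dots> \<le> inverse (real (Suc n))" using lt[of n] by simp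
    finally show ?thesis using pos[of x] by (simp add: field_simps)
  qed
  show ?thesis
  proof (rule borel_measurable_LIMSEQ_real)
    show "g n \<in> borel_measurable borel" for n
      using g[of n] by (auto simp: bcontfun_def intro: borel_measurable_continuous_onI)
    show "(\<lambda>n. g n x) \<longlonglongrightarrow> f x" for x
    proof -
      have "(\<lambda>n. g n x - f x) \<longlonglongrightarrow> 0"
      proof (rule Lim_null_comparison)
        show "\<forall>\<^sub>F n in sequentially. norm (g n x - f x) \<le> \<rho> x * inverse (real (Suc n))"
          using le by (auto simp: abs_minus_commute)
        show "(\<lambda>n. \<rho> x * inverse (real (Suc n))) \<longlonglongrightarrow> 0"
          using tendsto_mult[OF tendsto_const LIMSEQ_inverse_real_of_nat] by simp
      qed
      then show ?thesis by (simp add: LIM_zero_cancel)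
    qed
  qed
qed

lemma (in associated_Markov_process) adjoint_duality:
  assumes \<rho>: "admissible_weight \<rho>" and \<gamma>: "\<gamma> \<in> space (prob_algebra borel)" and t: "0 \<le> t"
    and \<phi>: "\<phi> \<in> calB \<rho>" and int: "integrable (adjoint_semigroup Pr \<Lambda> t \<gamma>) \<phi>"
  shows "(\<integral>x. P t \<phi> x \<partial>\<gamma>) = (\<integral>x. \<phi> x \<partial>adjoint_semigroup Pr \<Lambda> t \<gamma>)"
proof -
  let ?k = "\<lambda>x. distr (Pr x) borel (\<Lambda> t)"
  have m[measurable]: "\<phi> \<in> borel_measurable borel" using borel_measurable_calB[OF \<rho> \<phi>] .
  have s[measurable_cong]: "sets \<gamma> = sets borel" using \<gamma> by (simp add: space_prob_algebra)
  have kp: "?k \<in> \<gamma> \<rightarrow>\<^sub>M subprob_algebra borel"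
    using measurable_prob_algebraD[OF kernel[OF t]] s by simp
  note [measurable] = kp
  have L: "\<Lambda> t \<in> Pr x \<rightarrow>\<^sub>M borel" for x
    using adapted[OF t] subalgebra[OF t] sets_Pr[of x]
      measurable_from_subalg measurable_cong_sets by blast
  have nn: "(\<integral>\<^sup>+y. h y \<partial>adjoint_semigroup Pr \<Lambda> t \<gamma>) = (\<integral>\<^sup>+x. \<integral>\<^sup>+y. h y \<partial>?k x \<partial>\<gamma>)"
    if "h \<in> borel_measurable borel" for h
    unfolding adjoint_semigroup_def using nn_integral_bind[OF that kp] .
  have sA: "sets (adjoint_semigroup Pr \<Lambda> t \<gamma>) = sets borel"
    unfolding adjoint_semigroup_def
    using \<gamma> kernel[OF t] by (intro sets_bind') auto
  have ik: "integrable (?k x) \<phi>" for x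
    using integrable[OF t \<phi>] L by (simp add: integrable_distr_eq)
  let ?p = "\<lambda>x. \<integral>\<^sup>+y. ennreal (\<phi> y) \<partial>?k x" and ?n = "\<lambda>x. \<integral>\<^sup>+y. ennreal (- \<phi> y) \<partial>?k x"
  have Pt: "P t \<phi> x = enn2real (?p x) - enn2real (?n x)" for x
    using expectation[OF t \<phi>] integral_distr[OF L m] real_lebesgue_integral_def[OF ik]
    by simp
  have fin: "?p x < \<infinity>" "?n x < \<infinity>" for x
    using ik[of x] by (auto simp: real_integrable_def less_top)
  have fin': "(\<integral>\<^sup>+x. ?p x \<partial>\<gamma>) < \<infinity>" "(\<integral>\<^sup>+x. ?n x \<partial>\<gamma>) < \<infinity>"
    using int by (auto simp: real_integrable_def nn less_top)
  have i: "integrable \<gamma> (\<lambda>x. enn2real (?p x))" "integrable \<gamma> (\<lambda>x. enn2real (?n x))"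
    using fin fin' by (auto intro!: integrableI_nonneg simp: less_top)
  have "(\<integral>x. P t \<phi> x \<partial>\<gamma>) = (\<integral>x. enn2real (?p x) \<partial>\<gamma>) - (\<integral>x. enn2real (?n x) \<partial>\<gamma>)"
    using i by (simp add: Pt)
  also have "(\<integral>x. enn2real (?p x) \<partial>\<gamma>) = enn2real (\<integral>\<^sup>+x. ?p x \<partial>\<gamma>)"
    using fin by (subst integral_eq_nn_integral) (auto simp: less_top)
  also have "(\<integral>x. enn2real (?n x) \<partial>\<gamma>) = enn2real (\<integral>\<^sup>+x. ?n x \<partial>\<gamma>)"
    using fin by (subst integral_eq_nn_integral) (auto simp: less_top)
  also have "enn2real (\<integral>\<^sup>+x. ?p x \<partial>\<gamma>) - enn2real (\<integral>\<^sup>+x. ?n x \<partial>\<gamma>)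
      = (\<integral>x. \<phi> x \<partial>adjoint_semigroup Pr \<Lambda> t \<gamma>)"
    by (simp add: real_lebesgue_integral_def[OF int] nn)
  finally show ?thesis .
qed

end

theory Submission
  imports Defs
begin

text \<open>The argument is that of Krylov and Bogoliubov. Write \<open>\<nu> t\<close> for the law at time \<open>t\<close> and \<open>A n\<close> for
  its average over \<open>[0, T n]\<close>. For a bounded continuous \<open>g\<close>, duality and the semigroup property give
  \<open>\<integral> P s g d\<nu> t = \<integral> g d\<nu> (t + s)\<close>, so that \<open>\<integral> P s g dA n\<close> and \<open>\<integral> g dA n\<close> are averages of the same
  function of time over \<open>[s, T n + s]\<close> and \<open>[0, T n]\<close>. They differ by at most \<open>2 * s * sup \<bar>g\<bar> / T n\<close>
  (lemma \<open>integral_shift_difference_le\<close>), which tends to 0.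

  As \<open>P s g\<close> lies in \<^const>\<open>calB\<close> but need not be continuous, weak convergence does not apply to it
  directly. The moment condition closes this gap: it bounds \<open>\<integral> \<bar>g\<bar> dA n\<close> by a constant times the
  weighted norm of \<open>g\<close>, uniformly in \<open>n\<close>. For bounded continuous \<open>g\<close> this bound passes to \<open>\<mu>\<close> by weak convergence,
  and by Fatou's lemma it then holds for all of \<^const>\<open>calB\<close> (lemma \<open>calB_limit_integral_bound\<close>). Hence
  \<open>\<integral> f dA n\<close> converges to \<open>\<integral> f d\<mu>\<close> for every \<open>f\<close> in \<^const>\<open>calB\<close> (lemma
  \<open>integral_calB_tendsto\<close>). No portmanteau theorem for the lower semicontinuous weight is used, so
  \<open>\<mu>\<close> may fail to be Radon. The same bound extends the invariance from bounded continuous functions to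
  \<^const>\<open>calB\<close>.

  It remains to see that \<^const>\<open>time_average\<close> is a true average although no joint measurability of the
  process in time and sample point is given. Its limit has mass 1, so it is eventually not the null
  measure, hence countably additive; and additivity on a set and its complement forces
  \<open>t \<mapsto> \<nu> t A\<close> to be Lebesgue measurable (lemmas \<open>borel_measurable_of_complementary_nn_integrals\<close> and
  \<open>measurable_laws\<close>).\<close>

section \<open>Lower integrals and measurability\<close>

text \<open>Since \<^const>\<open>nn_integral\<close> is the supremum over simple functions below the integrand, it is a
  lower integral for an arbitrary \<open>f\<close>, and some measurable function below \<open>f\<close> attains it.\<close>

lemma nn_integral_eq_measurable_minorant:
  obtains g where "g \<in> borel_measurable M" "\<And>x. g x \<le> f x"
    "(\<integral>\<^sup>+x. g x \<partial>M) = (\<integral>\<^sup>+x. f x \<partial>M)"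
proof -
  let ?S = "{g. simple_function M g \<and> g \<le> f}"
  have "?S \<noteq> {}" by (auto intro!: exI[of _ "\<lambda>_. 0"] simp: le_fun_def)
  then obtain h :: "nat \<Rightarrow> ennreal" where h: "range h \<subseteq> integral\<^sup>S M ` ?S"
      "(\<integral>\<^sup>+x. f x \<partial>M) = (SUP i. h i)"
    unfolding nn_integral_def by (metis (no_types, lifting) ennreal_SUP_countable_SUP)
  have "\<forall>i. \<exists>s. s \<in> ?S \<and> h i = integral\<^sup>S M s" using h(1) by auto
  then obtain s where s: "\<And>i. s i \<in> ?S" "\<And>i. h i = integral\<^sup>S M (s i)" by metis
  define g where "g x = (SUP i. s i x)" for x
  show ?thesis
  proof
    show "g \<in> borel_measurable M"
      unfolding g_def[abs_def] using s(1)
      by (intro borel_measurable_SUP borel_measurable_simple_function) auto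
    show le: "g x \<le> f x" for x
      using s(1) by (auto simp: g_def le_fun_def intro!: SUP_least)
    have "h i \<le> (\<integral>\<^sup>+x. g x \<partial>M)" for i
      using s by (auto simp: g_def nn_integral_eq_simple_integral[symmetric]
          intro!: nn_integral_mono SUP_upper)
    then show "(\<integral>\<^sup>+x. g x \<partial>M) = (\<integral>\<^sup>+x. f x \<partial>M)"
      unfolding h(2) by (intro antisym SUP_least) (auto simp: le simp flip: h(2) intro!: nn_integral_mono)
  qed
qed

lemma (in complete_measure) borel_measurable_AE_eq:
  fixes f :: "'a \<Rightarrow> 'b::topological_space"
  assumes g: "g \<in> borel_measurable M" and ae: "AE x in M. f x = g x"
  shows "f \<in> borel_measurable M"
proof (rule measurableI)
  fix A :: "'b set" assume A: "A \<in> sets borel"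
  show "f -` A \<inter> space M \<in> sets M"
  proof (rule in_sets_AE)
    show "AE x in M. (x \<in> g -` A \<inter> space M) = (x \<in> f -` A \<inter> space M)"
      using ae by eventually_elim auto
    show "g -` A \<inter> space M \<in> sets M" using g A by (rule measurable_sets)
  qed auto
qed auto

text \<open>The integrals of the arbitrary functions \<open>u\<close> and \<open>v = 1 - u\<close> are lower integrals, so the
  hypothesis \<open>int\<close> says that the lower and the upper integral of \<open>u\<close> agree.\<close>

lemma borel_measurable_of_complementary_nn_integrals:
  fixes u v :: "'a \<Rightarrow> ennreal"
  assumes "complete_measure M" and fin: "finite_measure M"
    and uv: "\<And>x. x \<in> space M \<Longrightarrow> u x + v x = 1"
    and int: "(\<integral>\<^sup>+x. u x \<partial>M) + (\<integral>\<^sup>+x. v x \<partial>M) = emeasure M (space M)"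
  shows "u \<in> borel_measurable M"
proof -
  interpret complete_measure M by fact
  interpret finite_measure M by fact
  obtain g where g[measurable]: "g \<in> borel_measurable M" and gu: "\<And>x. g x \<le> u x"
    and gI: "(\<integral>\<^sup>+x. g x \<partial>M) = (\<integral>\<^sup>+x. u x \<partial>M)"
    using nn_integral_eq_measurable_minorant[of M u] by blast
  obtain h where h[measurable]: "h \<in> borel_measurable M" and hv: "\<And>x. h x \<le> v x"
    and hI: "(\<integral>\<^sup>+x. h x \<partial>M) = (\<integral>\<^sup>+x. v x \<partial>M)"
    using nn_integral_eq_measurable_minorant[of M v] by blast
  have le: "g x + h x \<le> 1" if "x \<in> space M" for x
    using add_mono[OF gu hv] uv[OF that] by metis
  \<comment> \<open>The measurable minorants of \<open>u\<close> and \<open>v\<close> already have the total integral of \<open>1\<close>, so their sum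
    is almost everywhere \<open>1\<close>, which leaves no room between \<open>g\<close> and \<open>u\<close>.\<close>
  have gh: "(\<integral>\<^sup>+x. g x + h x \<partial>M) = emeasure M (space M)"
    by (simp add: nn_integral_add gI hI int)
  have "(\<integral>\<^sup>+x. 1 - (g x + h x) \<partial>M) = (\<integral>\<^sup>+x. 1 \<partial>M) - (\<integral>\<^sup>+x. g x + h x \<partial>M)"
    by (rule nn_integral_diff) (auto simp: gh le)
  then have "(\<integral>\<^sup>+x. 1 - (g x + h x) \<partial>M) = 0" by (simp add: gh)
  then have "AE x in M. 1 - (g x + h x) = 0" by (subst (asm) nn_integral_0_iff_AE) auto
  then have "AE x in M. u x = g x"
    using AE_space
  proof eventually_elim
    case (elim x)
    have "1 \<le> g x + h x" using elim(1) by (simp add: diff_eq_0_iff_ennreal ennreal_minus_eq_0)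
    moreover have "u x + h x \<le> 1"
      using add_left_mono[OF hv[of x], of "u x"] uv[OF elim(2)] by simp
    ultimately have "h x + u x \<le> h x + g x" by (metis add.commute order_trans)
    moreover have "h x \<noteq> top"
      using add_increasing[OF zero_le order_refl, of "g x" "h x"] le[OF elim(2)]
      by (auto simp: top_unique)
    ultimately have "u x \<le> g x" by (simp add: ennreal_add_left_cancel_le)
    then show ?case using gu[of x] by simp
  qed
  then show ?thesis using g by (rule borel_measurable_AE_eq[rotated])
qed

lemma complete_measure_lebesgue_on:
  assumes "S \<in> sets lebesgue"
  shows "complete_measure (lebesgue_on S)"
proof
  fix A B :: "'a set" assume BA: "B \<subseteq> A" and A: "A \<in> null_sets (lebesgue_on S)"
  have "A \<subseteq> S" "A \<in> null_sets lebesgue"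
    using A null_sets_restrict_space[OF assms, of A] by auto
  then have "B \<subseteq> S" "B \<in> null_sets lebesgue"
    using BA completion.complete2 by (blast, blast)
  then show "B \<in> sets (lebesgue_on S)"
    using null_sets_restrict_space[OF assms, of B] by auto
qed

section \<open>Time averages of laws\<close>

text \<open>Probability measures \<open>\<nu> t\<close> whose time average over \<open>[0, T]\<close> is not the null measure. No
  measurability in \<open>t\<close> is assumed: it follows from \<open>nonnull\<close>, because \<^const>\<open>time_average\<close> is the null
  measure unless the averaged set function is countably additive.\<close>

locale averaged_laws =
  fixes \<nu> :: "real \<Rightarrow> 'a::topological_space measure" and T :: real
  assumes prob: "\<And>t. t \<in> {0..T} \<Longrightarrow> \<nu> t \<in> space (prob_algebra borel)"
    and T_pos: "0 < T"
    and nonnull: "measure (time_average \<nu> T) UNIV \<noteq> 0"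
begin

lemma nn_integral_Icc:
  "(\<integral>\<^sup>+t\<in>{0..T}. f t \<partial>lborel) = (\<integral>\<^sup>+t. f t \<partial>lebesgue_on {0..T})"
  by (simp add: nn_integral_restrict_space nn_integral_completion)

lemma laws: "t \<in> {0..T} \<Longrightarrow> prob_space (\<nu> t)" "t \<in> {0..T} \<Longrightarrow> sets (\<nu> t) = sets borel"
  "t \<in> {0..T} \<Longrightarrow> space (\<nu> t) = UNIV"
  using prob[of t] by (auto simp: space_prob_algebra dest: sets_eq_imp_space_eq)

lemma measure_space_average:
  "measure_space UNIV (sets borel)
    (\<lambda>A. ennreal (1 / T) * (\<integral>\<^sup>+t. emeasure (\<nu> t) A \<partial>lebesgue_on {0..T}))"
proof (rule ccontr)
  assume "\<not> ?thesis"
  then have "emeasure (time_average \<nu> T) UNIV = 0"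
    using sets.sigma_sets_eq[of "borel :: 'a measure"]
    by (simp add: time_average_def nn_integral_Icc emeasure_measure_of_conv)
  then show False using nonnull by (simp add: measure_def)
qed

lemma emeasure_average:
  assumes "A \<in> sets borel"
  shows "emeasure (time_average \<nu> T) A
    = ennreal (1 / T) * (\<integral>\<^sup>+t. emeasure (\<nu> t) A \<partial>lebesgue_on {0..T})"
  using measure_space_average assms sets.sigma_sets_eq[of "borel :: 'a measure"]
  by (simp add: time_average_def nn_integral_Icc emeasure_measure_of_conv)

lemma sets_average: "sets (time_average \<nu> T) = sets borel"
  using sets.sigma_sets_eq[of "borel :: 'a measure"]
  by (simp add: time_average_def sets_measure_of_conv)

lemma finite_lebesgue_on: "finite_measure (lebesgue_on {0..T})"
  using T_pos by (auto intro!: finite_measureI simp: emeasure_restrict_space)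

text \<open>Additivity of the average on a Borel set \<open>A\<close> and its complement is exactly the condition under
  which \<open>t \<mapsto> \<nu> t A\<close> is Lebesgue measurable. Borel measurability need not hold, so the integration in \<open>t\<close>
  is done over Lebesgue measure from here on.\<close>

lemma measurable_laws: "\<nu> \<in> lebesgue_on {0..T} \<rightarrow>\<^sub>M prob_algebra borel"
proof (intro measurable_prob_algebraI measurable_subprob_algebra)
  fix A :: "'a set" assume A: "A \<in> sets borel"
  let ?L = "lebesgue_on {0..T}"
  let ?m = "\<lambda>A. \<integral>\<^sup>+t. emeasure (\<nu> t) A \<partial>?L"
  have one: "emeasure (\<nu> t) UNIV = 1" if "t \<in> {0..T}" for t
    using prob_space.emeasure_space_1[OF laws(1)[OF that]] laws(3)[OF that] by simp
  show "(\<lambda>t. emeasure (\<nu> t) A) \<in> borel_measurable ?L"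
  proof (rule borel_measurable_of_complementary_nn_integrals[where v = "\<lambda>t. emeasure (\<nu> t) (- A)"])
    show "complete_measure ?L" by (rule complete_measure_lebesgue_on) auto
    show "emeasure (\<nu> t) A + emeasure (\<nu> t) (- A) = 1" if "t \<in> space ?L" for t
      using that A one laws(2)[of t]
      by (subst plus_emeasure) (auto simp: Compl_partition)
    have add: "emeasure (time_average \<nu> T) A + emeasure (time_average \<nu> T) (- A)
        = emeasure (time_average \<nu> T) UNIV"
      using A by (subst plus_emeasure) (auto simp: sets_average Compl_partition)
    have "- A \<in> sets borel" using A by simp
    with add A have "ennreal (1 / T) * (?m A + ?m (- A)) = ennreal (1 / T) * ?m UNIV"
      by (simp add: emeasure_average distrib_left)
    moreover have "ennreal (1 / T) \<noteq> 0" "ennreal (1 / T) \<noteq> top" using T_pos by auto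
    ultimately have "?m A + ?m (- A) = ?m UNIV" by (simp add: ennreal_mult_cancel_left)
    also have "?m UNIV = (\<integral>\<^sup>+t. 1 \<partial>?L)" by (intro nn_integral_cong) (auto simp: one)
    finally show "?m A + ?m (- A) = emeasure ?L (space ?L)" by simp
  qed (rule finite_lebesgue_on)
qed (auto simp: laws intro!: prob_space_imp_subprob_space)

lemma time_average_eq_bind:
  "time_average \<nu> T = density (lebesgue_on {0..T}) (\<lambda>_. ennreal (1 / T)) \<bind> \<nu>" (is "_ = ?D \<bind> \<nu>")
proof -
  have m[measurable]: "\<nu> \<in> ?D \<rightarrow>\<^sub>M subprob_algebra borel"
    using measurable_prob_algebraD[OF measurable_laws] by simp
  have ne: "space ?D \<noteq> {}" using T_pos by simp
  have s: "sets (?D \<bind> \<nu>) = sets borel"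
    using sets_bind[OF _ ne, of \<nu> borel] laws by simp
  show ?thesis
  proof (rule measure_eqI)
    fix A assume "A \<in> sets (time_average \<nu> T)"
    then have A: "A \<in> sets borel" by (simp add: sets_average)
    have [measurable]: "(\<lambda>t. emeasure (\<nu> t) A) \<in> borel_measurable (lebesgue_on {0..T})"
      using measurable_emeasure_kernel[OF m A] by simp
    show "emeasure (time_average \<nu> T) A = emeasure (?D \<bind> \<nu>) A"
      using A by (simp add: emeasure_average emeasure_bind[OF ne m A] nn_integral_density nn_integral_cmult)
  qed (simp add: s sets_average)
qed

lemma nn_integral_average:
  assumes f: "f \<in> borel_measurable borel"
  shows "(\<integral>\<^sup>+x. f x \<partial>time_average \<nu> T)
    = ennreal (1 / T) * (\<integral>\<^sup>+t. \<integral>\<^sup>+x. f x \<partial>\<nu> t \<partial>lebesgue_on {0..T})"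
proof -
  let ?D = "density (lebesgue_on {0..T}) (\<lambda>_. ennreal (1 / T))"
  have m: "\<nu> \<in> lebesgue_on {0..T} \<rightarrow>\<^sub>M subprob_algebra borel"
    by (rule measurable_prob_algebraD[OF measurable_laws])
  have [measurable]: "(\<lambda>t. \<integral>\<^sup>+x. f x \<partial>\<nu> t) \<in> borel_measurable (lebesgue_on {0..T})"
    using measurable_compose[OF m nn_integral_measurable_subprob_algebra[OF f]] .
  show ?thesis
    unfolding time_average_eq_bind using f m
    by (subst nn_integral_bind[where B=borel]) (simp_all add: nn_integral_density nn_integral_cmult)
qed

lemma prob_space_average: "time_average \<nu> T \<in> space (prob_algebra borel)"
proof -
  have "emeasure (time_average \<nu> T) UNIV = ennreal (1 / T) * (\<integral>\<^sup>+t. 1 \<partial>lebesgue_on {0..T})"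
    using prob_space.emeasure_space_1[OF laws(1)] laws(3)
    by (simp only: emeasure_average sets.top space_borel[symmetric])
      (auto intro!: nn_integral_cong arg_cong2[where f="(*)"] simp del: nn_integral_const)
  also have "\<dots> = 1"
    using T_pos by (simp add: emeasure_restrict_space flip: ennreal_mult')
  finally show ?thesis
    using sets_eq_imp_space_eq[OF sets_average]
    by (auto simp: space_prob_algebra sets_average intro!: prob_spaceI)
qed

lemma integral_average:
  fixes f :: "'a \<Rightarrow> real"
  assumes f: "f \<in> borel_measurable borel" and bd: "\<And>x. \<bar>f x\<bar> \<le> B"
  shows "integrable (lebesgue_on {0..T}) (\<lambda>t. \<integral>x. f x \<partial>\<nu> t)"
    and "(\<integral>x. f x \<partial>time_average \<nu> T) = (1 / T) * (\<integral>t. (\<integral>x. f x \<partial>\<nu> t) \<partial>lebesgue_on {0..T})"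
proof -
  let ?L = "lebesgue_on {0..T}" and ?D = "density (lebesgue_on {0..T}) (\<lambda>_. ennreal (1 / T))"
  interpret L: finite_measure ?L by (rule finite_lebesgue_on)
  have m: "\<nu> \<in> ?L \<rightarrow>\<^sub>M subprob_algebra borel"
    by (rule measurable_prob_algebraD[OF measurable_laws])
  have F[measurable]: "(\<lambda>t. \<integral>x. f x \<partial>\<nu> t) \<in> borel_measurable ?L"
    using measurable_compose[OF m integral_measurable_subprob_algebra[OF f]] .
  have "0 \<le> B" using bd[of undefined] by linarith
  have "\<bar>\<integral>x. f x \<partial>\<nu> t\<bar> \<le> B" if t: "t \<in> {0..T}" for t
  proof -
    interpret prob_space "\<nu> t" using laws(1)[OF t] .
    have "integrable (\<nu> t) f"
      using f bd laws(2)[OF t] by (intro integrable_const_bound[where B=B]) (auto cong: measurable_cong_sets)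
    then have "\<bar>\<integral>x. f x \<partial>\<nu> t\<bar> \<le> (\<integral>x. B \<partial>\<nu> t)"
      using bd by (intro integral_abs_bound[THEN order_trans] integral_mono) auto
    then show ?thesis by (simp add: prob_space)
  qed
  then show "integrable ?L (\<lambda>t. \<integral>x. f x \<partial>\<nu> t)"
    by (intro L.integrable_const_bound[where B=B]) auto
  have "(\<integral>x. f x \<partial>time_average \<nu> T) = (\<integral>t. (\<integral>x. f x \<partial>\<nu> t) \<partial>?D)"
    unfolding time_average_eq_bind
  proof (rule integral_bind[where B=B and B'=1 and K=borel])
    show "finite_measure ?D"
      using T_pos by (auto intro!: finite_measureI simp: emeasure_density_const
          emeasure_restrict_space ennreal_mult_eq_top_iff)
    show "AE t in ?D. emeasure (\<nu> t) (space (\<nu> t)) \<le> ennreal 1"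
      by (rule AE_I2) (use prob_space.emeasure_space_1[OF laws(1)] in auto)
  qed (use f m bd in auto)
  also have "\<dots> = (\<integral>t. (1 / T) *\<^sub>R (\<integral>x. f x \<partial>\<nu> t) \<partial>?L)"
    using T_pos by (intro integral_density) auto
  finally show "(\<integral>x. f x \<partial>time_average \<nu> T) = (1 / T) * (\<integral>t. (\<integral>x. f x \<partial>\<nu> t) \<partial>?L)"
    by simp
qed

end

text \<open>The integrals of \<open>F\<close> over \<open>[s, T + s]\<close> and \<open>[0, T]\<close> differ by integrals over two intervals of
  length \<open>s\<close>.\<close>

lemma integral_shift_difference_le:
  fixes F :: "real \<Rightarrow> real"
  assumes int: "\<And>R. integrable (lebesgue_on {0..R}) F" and bd: "\<And>t. 0 \<le> t \<Longrightarrow> \<bar>F t\<bar> \<le> B"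
    and s: "0 \<le> s" and T: "0 \<le> T"
    and ints: "integrable (lebesgue_on {0..T}) (\<lambda>t. F (t + s))"
  shows "\<bar>(\<integral>t. F (t + s) \<partial>lebesgue_on {0..T}) - (\<integral>t. F t \<partial>lebesgue_on {0..T})\<bar> \<le> 2 * B * s"
proof -
  have B: "0 \<le> B" using bd[of 0] by simp
  have io: "F integrable_on {a..b}" if "0 \<le> a" for a b
    using integrable_on_lebesgue_on[OF int[of b]] that
    by (auto intro: integrable_on_subinterval)
  have le: "\<bar>integral {a..a + s} F\<bar> \<le> B * s" if "0 \<le> a" for a
    using has_integral_bound[OF B, of F "integral {a..a + s} F" a "a + s"] io[OF that, of "a + s"] bd that s
    by (auto simp: has_integral_integral)
  have "(\<integral>t. F (t + s) \<partial>lebesgue_on {0..T}) = integral {0..T} (\<lambda>t. F (t + s))"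
    by (rule lebesgue_integral_eq_integral[OF ints]) simp
  also have "\<dots> = integral {s..T + s} F"
    using integral_shift_real_ivl[of s s "T + s" F] by simp
  finally have 1: "(\<integral>t. F (t + s) \<partial>lebesgue_on {0..T}) = integral {s..T + s} F" .
  have 2: "(\<integral>t. F t \<partial>lebesgue_on {0..T}) = integral {0..T} F"
    by (rule lebesgue_integral_eq_integral[OF int]) simp
  have "integral {0..s} F + integral {s..T + s} F = integral {0..T + s} F"
    using s T by (intro Henstock_Kurzweil_Integration.integral_combine io) auto
  moreover have "integral {0..T} F + integral {T..T + s} F = integral {0..T + s} F"
    using s T by (intro Henstock_Kurzweil_Integration.integral_combine io) auto
  ultimately show ?thesis using le[of 0] le[of T] T unfolding 1 2 by simp
qed

section \<open>The weighted function space\<close>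

text \<open>Admissible weights are lower semicontinuous.\<close>

lemma borel_measurable_admissible_weight:
  fixes \<rho> :: "'a::t2_space \<Rightarrow> real"
  assumes "admissible_weight \<rho>"
  shows "\<rho> \<in> borel_measurable borel"
  unfolding borel_measurable_iff_le
proof
  fix R
  show "{x \<in> space borel. \<rho> x \<le> R} \<in> sets borel"
  proof (cases "0 < R")
    case True
    then show ?thesis
      using assms by (auto simp: admissible_weight_def intro!: borel_closed compact_imp_closed)
  next
    case False
    then have "{x \<in> space borel. \<rho> x \<le> R} = {}"
      using assms by (auto simp: admissible_weight_def not_less not_le intro: le_less_trans)
    then show ?thesis by simp
  qed
qed

lemma B_space_add:
  assumes pos: "\<And>x. 0 < \<rho> x" and f: "f \<in> B_space \<rho>" and g: "g \<in> B_space \<rho>"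
  shows "(\<lambda>x. f x + g x) \<in> B_space \<rho>"
proof -
  obtain a b where ab: "\<And>x. inverse (\<rho> x) * \<bar>f x\<bar> \<le> a" "\<And>x. inverse (\<rho> x) * \<bar>g x\<bar> \<le> b"
    using f g by (auto simp: B_space_def bdd_above_def)
  have "inverse (\<rho> x) * \<bar>f x + g x\<bar> \<le> a + b" for x
  proof -
    have "inverse (\<rho> x) * \<bar>f x + g x\<bar> \<le> inverse (\<rho> x) * (\<bar>f x\<bar> + \<bar>g x\<bar>)"
      using pos[of x] by (intro mult_left_mono) auto
    also have "\<dots> \<le> a + b" using ab[of x] by (simp add: distrib_left)
    finally show ?thesis .
  qed
  then show ?thesis by (auto simp: B_space_def bdd_above_def)
qed

lemma B_space_uminus: "f \<in> B_space \<rho> \<Longrightarrow> (\<lambda>x. - f x) \<in> B_space \<rho>"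
  by (simp add: B_space_def)

lemma B_space_diff:
  assumes "\<And>x. 0 < \<rho> x" "f \<in> B_space \<rho>" "g \<in> B_space \<rho>"
  shows "(\<lambda>x. f x - g x) \<in> B_space \<rho>"
  using B_space_add[OF assms(1,2) B_space_uminus[OF assms(3)]] by simp

lemma abs_le_wnorm:
  assumes pos: "\<And>x. 0 < \<rho> x" and f: "f \<in> B_space \<rho>"
  shows "\<bar>f x\<bar> \<le> wnorm \<rho> f * \<rho> x"
proof -
  have "inverse (\<rho> x) * \<bar>f x\<bar> \<le> wnorm \<rho> f"
    using f unfolding wnorm_def B_space_def by (intro cSUP_upper) auto
  then show ?thesis using pos[of x] by (simp add: field_simps)
qed

lemma wnorm_nonneg:
  assumes "\<And>x. 0 < \<rho> x" "f \<in> B_space \<rho>"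
  shows "0 \<le> wnorm \<rho> f"
  using order_trans[OF abs_ge_zero abs_le_wnorm[OF assms, of undefined]] assms(1)[of undefined]
  by (simp add: zero_le_mult_iff less_le_not_le)

lemma wnorm_le:
  assumes pos: "\<And>x. 0 < \<rho> x" and le: "\<And>x. \<bar>f x\<bar> \<le> a * \<rho> x"
  shows "wnorm \<rho> f \<le> a"
  unfolding wnorm_def
proof (rule cSUP_least)
  show "inverse (\<rho> x) * \<bar>f x\<bar> \<le> a" for x
    using pos[of x] le[of x] by (simp add: field_simps)
qed auto

lemma wnorm_triangle:
  assumes pos: "\<And>x. 0 < \<rho> x" and f: "f \<in> B_space \<rho>" and g: "g \<in> B_space \<rho>"
  shows "wnorm \<rho> g \<le> wnorm \<rho> f + wnorm \<rho> (\<lambda>x. f x - g x)"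
proof (rule wnorm_le[OF pos])
  show "\<bar>g x\<bar> \<le> (wnorm \<rho> f + wnorm \<rho> (\<lambda>x. f x - g x)) * \<rho> x" for x
    using abs_le_wnorm[OF pos f, of x] abs_le_wnorm[OF pos B_space_diff[OF pos f g], of x]
    by (simp add: distrib_right)
qed

lemma calB_obtain:
  assumes "f \<in> calB \<rho>" "0 < e"
  obtains g where "g \<in> bcontfun" "wnorm \<rho> (\<lambda>x. f x - g x) < e"
  using assms by (auto simp: calB_def)

lemma bcontfun_subset_calB:
  fixes \<rho> :: "'a::t2_space \<Rightarrow> real"
  assumes "admissible_weight \<rho>"
  shows "bcontfun \<subseteq> calB \<rho>"
proof
  fix g :: "'a \<Rightarrow> real" assume g: "g \<in> bcontfun"
  have "wnorm \<rho> (\<lambda>x. g x - g x) = 0" by (simp add: wnorm_def)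
  then show "g \<in> calB \<rho>"
    using g bcontfun_subset_B_space[OF assms] by (auto simp: calB_def intro!: bexI[of _ g])
qed

lemma bcontfun_abs:
  fixes g :: "'a::topological_space \<Rightarrow> real"
  shows "g \<in> bcontfun \<Longrightarrow> (\<lambda>x. \<bar>g x\<bar>) \<in> bcontfun"
  by (auto simp: bcontfun_def bounded_iff intro!: continuous_intros)

lemma bcontfun_diff:
  fixes g :: "'a::topological_space \<Rightarrow> real"
  assumes "g \<in> bcontfun" "h \<in> bcontfun"
  shows "(\<lambda>x. g x - h x) \<in> bcontfun"
proof -
  obtain a b where "\<And>x. \<bar>g x\<bar> \<le> a" "\<And>x. \<bar>h x\<bar> \<le> b"
    using assms by (auto simp: bcontfun_def bounded_iff)
  then have "\<bar>g x - h x\<bar> \<le> a + b" for x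
    by (meson abs_triangle_ineq4 add_mono order_trans)
  then show ?thesis
    using assms by (auto simp: bcontfun_def bounded_iff intro!: continuous_intros)
qed

lemma calB_diff_bcontfun:
  fixes \<rho> :: "'a::t2_space \<Rightarrow> real"
  assumes \<rho>: "admissible_weight \<rho>" and f: "f \<in> calB \<rho>" and g: "g \<in> bcontfun"
  shows "(\<lambda>x. f x - g x) \<in> calB \<rho>"
  unfolding calB_def
proof (intro CollectI conjI allI impI)
  have pos: "\<And>x. 0 < \<rho> x" using \<rho> by (simp add: admissible_weight_def)
  show "(\<lambda>x. f x - g x) \<in> B_space \<rho>"
    using f g bcontfun_subset_B_space[OF \<rho>] by (intro B_space_diff pos) (auto simp: calB_def)
  fix e :: real assume "0 < e"
  with f obtain h where h: "h \<in> bcontfun" "wnorm \<rho> (\<lambda>x. f x - h x) < e" by (rule calB_obtain)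
  then show "\<exists>k\<in>bcontfun. wnorm \<rho> (\<lambda>x. f x - g x - k x) < e"
    by (intro bexI[of _ "\<lambda>x. h x - g x"] bcontfun_diff g) auto
qed

section \<open>Weak limits under a moment bound\<close>

lemma prob_algebra_borelD:
  assumes "M \<in> space (prob_algebra borel)"
  shows "prob_space M" "sets M = sets borel" "space M = UNIV"
  using assms by (auto simp: space_prob_algebra dest: sets_eq_imp_space_eq)

lemma integrable_bcontfun:
  fixes g :: "'a::topological_space \<Rightarrow> real"
  assumes M: "M \<in> space (prob_algebra borel)" and g: "g \<in> bcontfun"
  shows "integrable M g"
proof -
  interpret prob_space M using prob_algebra_borelD[OF M] by simp
  obtain b where "\<And>x. \<bar>g x\<bar> \<le> b" using g by (auto simp: bcontfun_def bounded_iff)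
  moreover have "g \<in> borel_measurable M"
    using g measurable_cong_sets[OF prob_algebra_borelD(2)[OF M] refl]
    by (auto simp: bcontfun_def intro: borel_measurable_continuous_onI)
  ultimately show ?thesis by (intro integrable_const_bound[where B=b]) auto
qed

lemma nn_integral_abs_le_wnorm:
  fixes \<rho> :: "'a \<Rightarrow> real"
  assumes pos: "\<And>x. 0 < \<rho> x" and m: "\<rho> \<in> borel_measurable M"
    and int: "(\<integral>\<^sup>+x. ennreal (\<rho> x) \<partial>M) \<le> ennreal S" and f: "f \<in> B_space \<rho>"
  shows "(\<integral>\<^sup>+x. ennreal \<bar>f x\<bar> \<partial>M) \<le> ennreal (wnorm \<rho> f * S)"
proof -
  have n: "0 \<le> wnorm \<rho> f" by (rule wnorm_nonneg[OF pos f])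
  have "(\<integral>\<^sup>+x. ennreal \<bar>f x\<bar> \<partial>M) \<le> (\<integral>\<^sup>+x. ennreal (wnorm \<rho> f) * ennreal (\<rho> x) \<partial>M)"
    using abs_le_wnorm[OF pos f] n
    by (intro nn_integral_mono) (auto simp flip: ennreal_mult' intro!: ennreal_leI)
  also have "\<dots> = ennreal (wnorm \<rho> f) * (\<integral>\<^sup>+x. ennreal (\<rho> x) \<partial>M)"
    using m by (intro nn_integral_cmult) auto
  also have "\<dots> \<le> ennreal (wnorm \<rho> f) * ennreal S" using int by (intro mult_left_mono) auto
  finally show ?thesis using n by (simp add: ennreal_mult')
qed

lemma integral_bound_of_nn_integral:
  fixes f :: "'a \<Rightarrow> real"
  assumes f: "f \<in> borel_measurable M" and le: "(\<integral>\<^sup>+x. ennreal \<bar>f x\<bar> \<partial>M) \<le> ennreal c" and c: "0 \<le> c"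
  shows "integrable M f" and "\<bar>\<integral>x. f x \<partial>M\<bar> \<le> c"
proof -
  show i: "integrable M f"
    using f le by (auto simp: integrable_iff_bounded intro: le_less_trans)
  have "ennreal \<bar>\<integral>x. f x \<partial>M\<bar> \<le> (\<integral>\<^sup>+x. ennreal \<bar>f x\<bar> \<partial>M)"
    using integral_norm_bound_ennreal[OF i] by simp
  also note le
  finally show "\<bar>\<integral>x. f x \<partial>M\<bar> \<le> c" using c by (simp add: ennreal_le_iff)
qed

text \<open>Probability measures that converge weakly and have a common bound on the integral of the weight.
  Neither the measures \<open>M n\<close> nor the limit \<open>\<mu>\<close> are assumed to be Radon, and \<open>\<rho>\<close> need not be
  \<open>\<mu>\<close>-integrable.\<close>

locale weak_limit_moment =
  fixes \<rho> :: "'a::t2_space \<Rightarrow> real" and M :: "nat \<Rightarrow> 'a measure" and \<mu> :: "'a measure" and S :: real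
  assumes \<rho>: "admissible_weight \<rho>"
    and M: "\<And>n. M n \<in> space (prob_algebra borel)"
    and \<mu>: "\<mu> \<in> space (prob_algebra borel)"
    and conv: "weakly_converges M \<mu>"
    and moment: "\<And>n. (\<integral>\<^sup>+x. ennreal (\<rho> x) \<partial>M n) \<le> ennreal S"
    and S: "0 \<le> S"
begin

lemma pos: "0 < \<rho> x" using \<rho> by (simp add: admissible_weight_def)

lemma measurable_M: "f \<in> borel_measurable borel \<Longrightarrow> f \<in> borel_measurable (M n)"
  using measurable_cong_sets[OF prob_algebra_borelD(2)[OF M] refl] by blast

lemma measurable_\<mu>: "f \<in> borel_measurable borel \<Longrightarrow> f \<in> borel_measurable \<mu>"
  using measurable_cong_sets[OF prob_algebra_borelD(2)[OF \<mu>] refl] by blast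

lemma measurable_calB: "f \<in> calB \<rho> \<Longrightarrow> f \<in> borel_measurable borel"
  by (rule borel_measurable_calB[OF \<rho>])

lemma calB_B: "f \<in> calB \<rho> \<Longrightarrow> f \<in> B_space \<rho>" by (simp add: calB_def)

lemma bcontfun_B: "g \<in> bcontfun \<Longrightarrow> g \<in> B_space \<rho>" using bcontfun_subset_B_space[OF \<rho>] by blast

lemma calB_integral_bound:
  assumes f: "f \<in> calB \<rho>"
  shows "integrable (M n) f" "\<bar>\<integral>x. f x \<partial>M n\<bar> \<le> wnorm \<rho> f * S"
proof -
  have n: "0 \<le> wnorm \<rho> f * S" using wnorm_nonneg[OF pos calB_B[OF f]] S by simp
  have "(\<integral>\<^sup>+x. ennreal \<bar>f x\<bar> \<partial>M n) \<le> ennreal (wnorm \<rho> f * S)"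
    by (rule nn_integral_abs_le_wnorm[OF pos _ moment calB_B[OF f]])
      (intro measurable_M borel_measurable_admissible_weight \<rho>)
  from integral_bound_of_nn_integral[OF measurable_M[OF measurable_calB[OF f]] this n]
  show "integrable (M n) f" "\<bar>\<integral>x. f x \<partial>M n\<bar> \<le> wnorm \<rho> f * S" by auto
qed

text \<open>The bound passes to the limit by testing the weak convergence with \<open>\<bar>g\<bar>\<close>, which is itself
  bounded and continuous; the weight is not integrated against \<open>\<mu>\<close>.\<close>

lemma nn_integral_bcontfun_limit:
  assumes g: "g \<in> bcontfun"
  shows "(\<integral>\<^sup>+x. ennreal \<bar>g x\<bar> \<partial>\<mu>) \<le> ennreal (wnorm \<rho> g * S)"
proof -
  have a: "(\<lambda>x. \<bar>g x\<bar>) \<in> bcontfun" by (rule bcontfun_abs[OF g])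
  have "wnorm \<rho> (\<lambda>x. \<bar>g x\<bar>) = wnorm \<rho> g" by (simp add: wnorm_def)
  then have "\<bar>\<integral>x. \<bar>g x\<bar> \<partial>M n\<bar> \<le> wnorm \<rho> g * S" for n
    using calB_integral_bound(2)[of "\<lambda>x. \<bar>g x\<bar>" n] a bcontfun_subset_calB[OF \<rho>] by auto
  then have "(\<integral>x. \<bar>g x\<bar> \<partial>M n) \<le> wnorm \<rho> g * S" for n by (rule order_trans[OF abs_ge_self])
  moreover have "(\<lambda>n. \<integral>x. \<bar>g x\<bar> \<partial>M n) \<longlonglongrightarrow> (\<integral>x. \<bar>g x\<bar> \<partial>\<mu>)"
    using conv a unfolding weakly_converges_def by blast
  ultimately have "(\<integral>x. \<bar>g x\<bar> \<partial>\<mu>) \<le> wnorm \<rho> g * S" by (intro LIMSEQ_le_const2) auto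
  then show ?thesis
    by (subst nn_integral_eq_integral[OF integrable_bcontfun[OF \<mu> a]]) (auto intro: ennreal_leI)
qed

text \<open>By Fatou's lemma, applied to bounded continuous approximants in the weighted norm, which also
  converge pointwise.\<close>

lemma calB_limit_integral_bound:
  assumes f: "f \<in> calB \<rho>"
  shows "integrable \<mu> f" "\<bar>\<integral>x. f x \<partial>\<mu>\<bar> \<le> wnorm \<rho> f * S"
proof -
  have "\<exists>g. g \<in> bcontfun \<and> wnorm \<rho> (\<lambda>x. f x - g x) < inverse (real (Suc m))" for m
    using calB_obtain[OF f, of "inverse (real (Suc m))"] by (metis inverse_positive_iff_positive of_nat_0_less_iff zero_less_Suc)
  then obtain g where g: "\<And>m. g m \<in> bcontfun"
    and lt: "\<And>m. wnorm \<rho> (\<lambda>x. f x - g m x) < inverse (real (Suc m))" by metis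
  let ?c = "\<lambda>m. (wnorm \<rho> f + inverse (real (Suc m))) * S"
  have lim: "(\<lambda>m. g m x) \<longlonglongrightarrow> f x" for x
  proof -
    have "\<bar>g m x - f x\<bar> \<le> inverse (real (Suc m)) * \<rho> x" for m
      using abs_le_wnorm[OF pos B_space_diff[OF pos calB_B[OF f] bcontfun_B[OF g[of m]]], of x]
        mult_right_mono[OF less_imp_le[OF lt[of m]] less_imp_le[OF pos[of x]]]
      by (simp add: abs_minus_commute)
    moreover have "(\<lambda>m. inverse (real (Suc m)) * \<rho> x) \<longlonglongrightarrow> 0"
      using tendsto_mult[OF LIMSEQ_inverse_real_of_nat tendsto_const] by simp
    ultimately have "(\<lambda>m. g m x - f x) \<longlonglongrightarrow> 0"
      by (intro Lim_null_comparison[of "\<lambda>m. g m x - f x"]) auto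
    then show ?thesis by (simp add: LIM_zero_cancel)
  qed
  have "(\<integral>\<^sup>+x. ennreal \<bar>f x\<bar> \<partial>\<mu>) = (\<integral>\<^sup>+x. liminf (\<lambda>m. ennreal \<bar>g m x\<bar>) \<partial>\<mu>)"
    using lim by (intro nn_integral_cong lim_imp_Liminf[symmetric]) (auto intro!: tendsto_intros)
  also have "\<dots> \<le> liminf (\<lambda>m. \<integral>\<^sup>+x. ennreal \<bar>g m x\<bar> \<partial>\<mu>)"
    using integrable_bcontfun[OF \<mu> g] by (intro nn_integral_liminf) auto
  also have "\<dots> \<le> liminf (\<lambda>m. ennreal (?c m))"
  proof (intro Liminf_mono always_eventually allI)
    fix m
    have "wnorm \<rho> (g m) \<le> wnorm \<rho> f + inverse (real (Suc m))"
      using wnorm_triangle[OF pos calB_B[OF f] bcontfun_B[OF g[of m]]] lt[of m] by simp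
    then show "(\<integral>\<^sup>+x. ennreal \<bar>g m x\<bar> \<partial>\<mu>) \<le> ennreal (?c m)"
      by (intro order_trans[OF nn_integral_bcontfun_limit[OF g]] ennreal_leI mult_right_mono S)
  qed
  also have "\<dots> = ennreal (wnorm \<rho> f * S)"
  proof (rule lim_imp_Liminf)
    have "?c \<longlonglongrightarrow> (wnorm \<rho> f + 0) * S" by (intro tendsto_intros LIMSEQ_inverse_real_of_nat)
    then show "(\<lambda>m. ennreal (?c m)) \<longlonglongrightarrow> ennreal (wnorm \<rho> f * S)" by (intro tendsto_ennrealI) simp
  qed simp
  finally have le: "(\<integral>\<^sup>+x. ennreal \<bar>f x\<bar> \<partial>\<mu>) \<le> ennreal (wnorm \<rho> f * S)" .
  have n: "0 \<le> wnorm \<rho> f * S" using wnorm_nonneg[OF pos calB_B[OF f]] S by simp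
  from integral_bound_of_nn_integral[OF measurable_\<mu>[OF measurable_calB[OF f]] le n]
  show "integrable \<mu> f" "\<bar>\<integral>x. f x \<partial>\<mu>\<bar> \<le> wnorm \<rho> f * S" by auto
qed

lemma integral_calB_tendsto:
  assumes f: "f \<in> calB \<rho>"
  shows "(\<lambda>n. \<integral>x. f x \<partial>M n) \<longlonglongrightarrow> (\<integral>x. f x \<partial>\<mu>)"
proof (rule LIMSEQ_I)
  fix e :: real assume e: "0 < e"
  define d where "d = e / (3 * (S + 1))"
  have d: "0 < d" "d * S < e / 3" using e S by (auto simp: d_def field_simps)
  obtain g where g: "g \<in> bcontfun" and lt: "wnorm \<rho> (\<lambda>x. f x - g x) < d"
    using calB_obtain[OF f d(1)] .
  have fg: "(\<lambda>x. f x - g x) \<in> calB \<rho>" by (rule calB_diff_bcontfun[OF \<rho> f g])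
  have small: "wnorm \<rho> (\<lambda>x. f x - g x) * S < e / 3"
    using mult_right_mono[OF less_imp_le[OF lt] S] d(2) by linarith
  have "(\<lambda>n. \<integral>x. g x \<partial>M n) \<longlonglongrightarrow> (\<integral>x. g x \<partial>\<mu>)"
    using conv g unfolding weakly_converges_def by blast
  then obtain N where N: "\<And>n. N \<le> n \<Longrightarrow> \<bar>(\<integral>x. g x \<partial>M n) - (\<integral>x. g x \<partial>\<mu>)\<bar> < e / 3"
    using LIMSEQ_D[of _ _ "e / 3"] e by (metis divide_pos_pos real_norm_def zero_less_numeral)
  have "\<bar>(\<integral>x. f x \<partial>M n) - (\<integral>x. f x \<partial>\<mu>)\<bar> < e" if "N \<le> n" for n
  proof -
    have "(\<integral>x. f x - g x \<partial>M n) = (\<integral>x. f x \<partial>M n) - (\<integral>x. g x \<partial>M n)"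
      by (intro Bochner_Integration.integral_diff calB_integral_bound(1) f integrable_bcontfun M g)
    moreover have "(\<integral>x. f x - g x \<partial>\<mu>) = (\<integral>x. f x \<partial>\<mu>) - (\<integral>x. g x \<partial>\<mu>)"
      by (intro Bochner_Integration.integral_diff calB_limit_integral_bound(1) f integrable_bcontfun \<mu> g)
    ultimately show ?thesis
      using calB_integral_bound(2)[OF fg, of n] calB_limit_integral_bound(2)[OF fg] N[OF that] small by linarith
  qed
  then show "\<exists>N. \<forall>n\<ge>N. norm ((\<integral>x. f x \<partial>M n) - (\<integral>x. f x \<partial>\<mu>)) < e" by auto
qed

end

section \<open>Laws of the Markov process\<close>

context associated_Markov_process
begin

lemma measurable_\<Lambda>: "0 \<le> t \<Longrightarrow> \<Lambda> t \<in> Pr x \<rightarrow>\<^sub>M borel"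
  using adapted[of t] subalgebra[of t] sets_Pr[of x]
    measurable_from_subalg measurable_cong_sets by blast

lemma adjoint_in_prob_algebra:
  assumes "\<gamma> \<in> space (prob_algebra borel)" "0 \<le> t"
  shows "adjoint_semigroup Pr \<Lambda> t \<gamma> \<in> space (prob_algebra borel)"
  unfolding adjoint_semigroup_def
  using measurable_space[OF measurable_bind_prob_space[OF measurable_ident kernel[OF assms(2)]] assms(1)]
  by simp

lemma nn_integral_adjoint:
  assumes \<gamma>: "\<gamma> \<in> space (prob_algebra borel)" and t: "0 \<le> t" and h: "h \<in> borel_measurable borel"
  shows "(\<integral>\<^sup>+x. h x \<partial>adjoint_semigroup Pr \<Lambda> t \<gamma>) = (\<integral>\<^sup>+x. (\<integral>\<^sup>+\<omega>. h (\<Lambda> t \<omega>) \<partial>Pr x) \<partial>\<gamma>)"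
proof -
  have s[measurable_cong]: "sets \<gamma> = sets borel" using \<gamma> by (simp add: space_prob_algebra)
  have "(\<lambda>x. distr (Pr x) borel (\<Lambda> t)) \<in> \<gamma> \<rightarrow>\<^sub>M subprob_algebra borel"
    using measurable_prob_algebraD[OF kernel[OF t]] s by simp
  then show ?thesis
    unfolding adjoint_semigroup_def
    by (simp add: nn_integral_bind[OF h] nn_integral_distr[OF measurable_\<Lambda>[OF t]] h)
qed

lemma abs_P_le:
  assumes t: "0 \<le> t" and \<phi>: "\<phi> \<in> calB \<rho>" and le: "\<And>x. \<bar>\<phi> x\<bar> \<le> b"
  shows "\<bar>P t \<phi> x\<bar> \<le> b"
proof -
  interpret prob_space "Pr x" by (rule prob_space)
  have "\<bar>\<integral>\<omega>. \<phi> (\<Lambda> t \<omega>) \<partial>Pr x\<bar> \<le> (\<integral>\<omega>. b \<partial>Pr x)"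
    using integrable[OF t \<phi>] le
    by (intro integral_abs_bound[THEN order_trans] integral_mono) auto
  then show ?thesis by (simp add: expectation[OF t \<phi>] prob_space)
qed

lemma integrable_adjoint:
  assumes \<rho>: "admissible_weight \<rho>" and \<gamma>: "\<gamma> \<in> space (prob_algebra borel)" and t: "0 \<le> t"
    and S: "(\<integral>\<^sup>+x. ennreal (\<rho> x) \<partial>adjoint_semigroup Pr \<Lambda> t \<gamma>) \<le> ennreal S" "0 \<le> S"
    and f: "f \<in> calB \<rho>"
  shows "integrable (adjoint_semigroup Pr \<Lambda> t \<gamma>) f"
proof (rule integral_bound_of_nn_integral)
  have pos: "\<And>x. 0 < \<rho> x" using \<rho> by (simp add: admissible_weight_def)
  have fB: "f \<in> B_space \<rho>" using f by (simp add: calB_def)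
  note cong = measurable_cong_sets[OF prob_algebra_borelD(2)[OF adjoint_in_prob_algebra[OF \<gamma> t]] refl]
  show "f \<in> borel_measurable (adjoint_semigroup Pr \<Lambda> t \<gamma>)"
    using borel_measurable_calB[OF \<rho> f] cong by blast
  have "\<rho> \<in> borel_measurable (adjoint_semigroup Pr \<Lambda> t \<gamma>)"
    using borel_measurable_admissible_weight[OF \<rho>] cong by blast
  then show "(\<integral>\<^sup>+x. ennreal \<bar>f x\<bar> \<partial>adjoint_semigroup Pr \<Lambda> t \<gamma>) \<le> ennreal (wnorm \<rho> f * S)"
    by (rule nn_integral_abs_le_wnorm[OF pos _ S(1) fB])
  show "0 \<le> wnorm \<rho> f * S" using wnorm_nonneg[OF pos fB] S(2) by simp
qed

end

section \<open>Invariance of the limit\<close>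

theorem lemma3p1:
  fixes \<rho> :: "'a::t2_space \<Rightarrow> real"
    and P :: "real \<Rightarrow> ('a \<Rightarrow> real) \<Rightarrow> ('a \<Rightarrow> real)"
    and \<Omega> :: "'w measure"
    and F :: "real \<Rightarrow> 'w measure"
    and Pr :: "'a \<Rightarrow> 'w measure"
    and \<Lambda> :: "real \<Rightarrow> 'w \<Rightarrow> 'a"
    and \<gamma> \<mu> :: "'a measure"
    and T :: "nat \<Rightarrow> real"
  assumes "completely_regular_space (euclidean :: 'a topology)"
    and "admissible_weight \<rho>"
    and "generalised_Feller_semigroup \<rho> P"
    and "associated_Markov_process \<rho> P \<Omega> F Pr \<Lambda>"
    and "\<gamma> \<in> space (prob_algebra borel)"
    and "\<And>n. 0 < T n"
    and "filterlim T at_top sequentially"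
    and "\<mu> \<in> space (prob_algebra borel)"
    and "weakly_converges (\<lambda>n. time_average (\<lambda>t. adjoint_semigroup Pr \<Lambda> t \<gamma>) (T n)) \<mu>"
    and "(SUP t\<in>{0..}. \<integral>\<^sup>+x. (\<integral>\<^sup>+\<omega>. ennreal (\<rho> (\<Lambda> t \<omega>)) \<partial>Pr x) \<partial>\<gamma>) < \<infinity>"
  shows "invariant_measure \<rho> P \<mu>"
proof -
  note \<rho> = assms(2) and \<gamma> = assms(5) and T_pos = assms(6) and T_lim = assms(7)
    and \<mu> = assms(8) and weak = assms(9) and moment = assms(10)
  interpret gF: generalised_Feller_semigroup \<rho> P by fact
  interpret M: associated_Markov_process \<rho> P \<Omega> F Pr \<Lambda> by fact
  define \<nu> where "\<nu> t = adjoint_semigroup Pr \<Lambda> t \<gamma>" for t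
  have pos: "\<And>x. 0 < \<rho> x" using \<rho> by (simp add: admissible_weight_def)
  have \<nu>: "\<nu> t \<in> space (prob_algebra borel)" if "0 \<le> t" for t
    unfolding \<nu>_def by (rule M.adjoint_in_prob_algebra[OF \<gamma> that])
  have \<rho>_m: "(\<lambda>x. ennreal (\<rho> x)) \<in> borel_measurable borel"
    using borel_measurable_admissible_weight[OF \<rho>] by simp
  define S where "S = enn2real (SUP t\<in>{0..}. \<integral>\<^sup>+x. (\<integral>\<^sup>+\<omega>. ennreal (\<rho> (\<Lambda> t \<omega>)) \<partial>Pr x) \<partial>\<gamma>)"
  have S: "0 \<le> S" by (simp add: S_def)
  have \<nu>S: "(\<integral>\<^sup>+x. ennreal (\<rho> x) \<partial>\<nu> t) \<le> ennreal S" if "0 \<le> t" for t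
  proof -
    have "(\<integral>\<^sup>+x. ennreal (\<rho> x) \<partial>\<nu> t) = (\<integral>\<^sup>+x. (\<integral>\<^sup>+\<omega>. ennreal (\<rho> (\<Lambda> t \<omega>)) \<partial>Pr x) \<partial>\<gamma>)"
      unfolding \<nu>_def by (rule M.nn_integral_adjoint[OF \<gamma> that \<rho>_m])
    also have "\<dots> \<le> (SUP t\<in>{0..}. \<integral>\<^sup>+x. (\<integral>\<^sup>+\<omega>. ennreal (\<rho> (\<Lambda> t \<omega>)) \<partial>Pr x) \<partial>\<gamma>)"
      using that by (intro SUP_upper) auto
    also have "\<dots> = ennreal S" using moment by (simp add: S_def less_top)
    finally show ?thesis .
  qed

  have P_B: "P s f \<in> calB \<rho>" if "0 \<le> s" "f \<in> calB \<rho>" for s f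
    using gF.bounded_operator[OF that(1)] that(2) unfolding bounded_operator_def by blast
  have int_\<nu>: "integrable (\<nu> t) f" if "0 \<le> t" "f \<in> calB \<rho>" for t f
    using M.integrable_adjoint[OF \<rho> \<gamma> that(1) _ S that(2)] \<nu>S[OF that(1)] by (simp add: \<nu>_def)
  have dual: "(\<integral>x. P t f x \<partial>\<gamma>) = (\<integral>x. f x \<partial>\<nu> t)" if "0 \<le> t" "f \<in> calB \<rho>" for t f
    using M.adjoint_duality[OF \<rho> \<gamma> that] int_\<nu>[OF that] by (simp add: \<nu>_def)
  have shift: "(\<integral>x. P s f x \<partial>\<nu> t) = (\<integral>x. f x \<partial>\<nu> (t + s))" if "0 \<le> s" "0 \<le> t" "f \<in> calB \<rho>" for s t f
    using dual[OF that(2) P_B[OF that(1,3)]] dual[of "t + s" f] gF.P_add[OF that] that by simp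

  \<comment> \<open>Testing the weak convergence with the constant 1 shows that the time averages are eventually
    nonnull, hence genuine averages.\<close>
  have one: "(\<lambda>_. 1 :: real) \<in> bcontfun" by (simp add: bcontfun_def)
  have "(\<lambda>n. \<integral>x. 1 \<partial>time_average \<nu> (T n)) \<longlonglongrightarrow> (\<integral>x. (1::real) \<partial>\<mu>)"
    using weak one unfolding weakly_converges_def \<nu>_def[abs_def] by blast
  moreover have "(\<integral>x. (1::real) \<partial>\<mu>) = 1"
    using prob_space.prob_space[OF prob_algebra_borelD(1)[OF \<mu>]] by simp
  ultimately have "\<forall>\<^sub>F n in sequentially. 0 < (\<integral>x. (1::real) \<partial>time_average \<nu> (T n))"
    by (intro order_tendstoD(1)[of _ 1]) auto
  then obtain N where N: "\<And>n. N \<le> n \<Longrightarrow> 0 < (\<integral>x. (1::real) \<partial>time_average \<nu> (T n))"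
    by (auto simp: eventually_sequentially)
  have spA: "space (time_average \<nu> R) = UNIV" for R by (simp add: time_average_def space_measure_of_conv)
  have avg: "averaged_laws \<nu> (T n)" if "N \<le> n" for n
    using N[OF that] \<nu> T_pos by unfold_locales (auto simp: spA)
  define T' where "T' n = T (n + N)" for n
  define A where "A n = time_average \<nu> (T' n)" for n
  have avg': "averaged_laws \<nu> (T' n)" for n unfolding T'_def by (rule avg) simp
  have T'_pos: "0 < T' n" for n by (simp add: T'_def T_pos)
  have T'_lim: "filterlim T' at_top sequentially"
    unfolding T'_def[abs_def] by (rule filterlim_compose[OF T_lim filterlim_add_const_nat_at_top])

  interpret W: weak_limit_moment \<rho> A \<mu> S
  proof
    show "A n \<in> space (prob_algebra borel)" for n
      unfolding A_def by (rule averaged_laws.prob_space_average[OF avg'])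
    show "weakly_converges A \<mu>"
      unfolding weakly_converges_def
    proof
      fix f :: "'a \<Rightarrow> real" assume "f \<in> bcontfun"
      then have "(\<lambda>n. \<integral>x. f x \<partial>time_average \<nu> (T n)) \<longlonglongrightarrow> (\<integral>x. f x \<partial>\<mu>)"
        using weak unfolding weakly_converges_def \<nu>_def[abs_def] by blast
      then show "(\<lambda>n. \<integral>x. f x \<partial>A n) \<longlonglongrightarrow> (\<integral>x. f x \<partial>\<mu>)"
        unfolding A_def T'_def by (rule LIMSEQ_ignore_initial_segment)
    qed
    show "(\<integral>\<^sup>+x. ennreal (\<rho> x) \<partial>A n) \<le> ennreal S" for n
    proof -
      have "(\<integral>\<^sup>+x. ennreal (\<rho> x) \<partial>A n)
          = ennreal (1 / T' n) * (\<integral>\<^sup>+t. \<integral>\<^sup>+x. ennreal (\<rho> x) \<partial>\<nu> t \<partial>lebesgue_on {0..T' n})"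
        unfolding A_def by (rule averaged_laws.nn_integral_average[OF avg' \<rho>_m])
      also have "\<dots> \<le> ennreal (1 / T' n) * (\<integral>\<^sup>+t. ennreal S \<partial>lebesgue_on {0..T' n})"
        by (intro mult_left_mono nn_integral_mono \<nu>S) auto
      also have "\<dots> = ennreal S"
        using T'_pos[of n] S by (simp add: emeasure_restrict_space flip: ennreal_mult')
      finally show ?thesis .
    qed
  qed (use \<rho> \<mu> S in auto)

  \<comment> \<open>The invariance argument: \<open>P s\<close> acts on the averages as a time shift by \<open>s\<close>.\<close>
  have bcont: "(\<integral>x. P s g x \<partial>\<mu>) = (\<integral>x. g x \<partial>\<mu>)" if s: "0 \<le> s" and g: "g \<in> bcontfun" for s g
  proof -
    have gB: "g \<in> calB \<rho>" using g bcontfun_subset_calB[OF \<rho>] by blast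
    obtain b where b: "\<And>x. \<bar>g x\<bar> \<le> b" using g by (auto simp: bcontfun_def bounded_iff)
    have Pb: "\<bar>P s g x\<bar> \<le> b" for x by (rule M.abs_P_le[OF s gB b])
    define G where "G t = (\<integral>x. g x \<partial>\<nu> t)" for t
    have G_bd: "\<bar>G t\<bar> \<le> b" if t: "0 \<le> t" for t
    proof -
      interpret prob_space "\<nu> t" by (rule prob_algebra_borelD[OF \<nu>[OF t]])
      have "\<bar>\<integral>x. g x \<partial>\<nu> t\<bar> \<le> (\<integral>x. b \<partial>\<nu> t)"
        using int_\<nu>[OF t gB] b by (intro integral_abs_bound[THEN order_trans] integral_mono) auto
      then show ?thesis by (simp add: G_def prob_space)
    qed
    have gm: "g \<in> borel_measurable borel" "P s g \<in> borel_measurable borel"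
      using borel_measurable_calB[OF \<rho>] gB P_B[OF s gB] by auto
    have G_int: "integrable (lebesgue_on {0..R}) G" for R
    proof -
      \<comment> \<open>The time averages give measurability on \<open>[0, T' n]\<close>, and these intervals exhaust \<open>[0, \<infinity>)\<close>.\<close>
      obtain n where "R \<le> T' n"
        using T'_lim unfolding filterlim_at_top eventually_sequentially by blast
      moreover have "integrable (lebesgue_on {0..T' n}) G"
        using averaged_laws.integral_average(1)[OF avg'[of n] gm(1) b] by (simp add: G_def[abs_def])
      ultimately show ?thesis by (intro integrable_subinterval[of 0 "T' n" G 0 R]) auto
    qed
    have eq: "(\<integral>x. P s g x \<partial>\<nu> t) = G (t + s)" if "0 \<le> t" for t
      using shift[OF s that gB] by (simp add: G_def)
    have int_s: "integrable (lebesgue_on {0..T' n}) (\<lambda>t. G (t + s))" for n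
      using averaged_laws.integral_average(1)[OF avg'[of n] gm(2) Pb]
      by (rule Bochner_Integration.integrable_cong[THEN iffD1, rotated -1]) (auto simp: eq)
    have A1: "(\<integral>x. P s g x \<partial>A n) = (1 / T' n) * (\<integral>t. G (t + s) \<partial>lebesgue_on {0..T' n})" for n
      unfolding A_def averaged_laws.integral_average(2)[OF avg' gm(2) Pb]
      by (intro arg_cong2[where f="(*)"] Bochner_Integration.integral_cong) (auto simp: eq)
    have A2: "(\<integral>x. g x \<partial>A n) = (1 / T' n) * (\<integral>t. G t \<partial>lebesgue_on {0..T' n})" for n
      unfolding A_def averaged_laws.integral_average(2)[OF avg' gm(1) b] by (simp add: G_def)
    have "norm ((\<integral>x. P s g x \<partial>A n) - (\<integral>x. g x \<partial>A n)) \<le> 2 * b * s / T' n" for n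
    proof -
      let ?d = "(\<integral>t. G (t + s) \<partial>lebesgue_on {0..T' n}) - (\<integral>t. G t \<partial>lebesgue_on {0..T' n})"
      have "(\<integral>x. P s g x \<partial>A n) - (\<integral>x. g x \<partial>A n) = ?d / T' n"
        unfolding A1 A2 by (simp add: diff_divide_distrib)
      moreover have "\<bar>?d\<bar> \<le> 2 * b * s"
        using T'_pos[of n] by (intro integral_shift_difference_le G_int G_bd s int_s) auto
      ultimately show ?thesis using T'_pos[of n] by (simp add: abs_divide divide_right_mono)
    qed
    moreover have "(\<lambda>n. 2 * b * s / T' n) \<longlonglongrightarrow> 0"
      by (intro tendsto_divide_0[OF tendsto_const] filterlim_at_top_imp_at_infinity T'_lim)
    ultimately have "(\<lambda>n. (\<integral>x. P s g x \<partial>A n) - (\<integral>x. g x \<partial>A n)) \<longlonglongrightarrow> 0"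
      by (rule Lim_null_comparison[OF always_eventually[OF allI]])
    moreover have "(\<lambda>n. (\<integral>x. P s g x \<partial>A n) - (\<integral>x. g x \<partial>A n)) \<longlonglongrightarrow> (\<integral>x. P s g x \<partial>\<mu>) - (\<integral>x. g x \<partial>\<mu>)"
      by (intro tendsto_diff W.integral_calB_tendsto P_B s gB)
    ultimately have "(\<integral>x. P s g x \<partial>\<mu>) - (\<integral>x. g x \<partial>\<mu>) = 0" by (rule LIMSEQ_unique[rotated])
    then show ?thesis by simp
  qed

  \<comment> \<open>Both sides are continuous in \<open>f\<close> for the weighted norm, so the identity extends from bounded
    continuous functions to their closure.\<close>
  have "(\<integral>x. P s f x \<partial>\<mu>) = (\<integral>x. f x \<partial>\<mu>)" if s: "0 \<le> s" and f: "f \<in> calB \<rho>" for s f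
  proof -
    obtain C where C: "\<And>h. h \<in> calB \<rho> \<Longrightarrow> wnorm \<rho> (P s h) \<le> C * wnorm \<rho> h"
      using gF.bounded_operator[OF s] unfolding bounded_operator_def by blast
    have add: "P s (\<lambda>x. h x + k x) = (\<lambda>x. P s h x + P s k x)"
      if "h \<in> calB \<rho>" "k \<in> calB \<rho>" for h k
      using gF.bounded_operator[OF s] that unfolding bounded_operator_def by blast
    have "\<bar>(\<integral>x. P s f x \<partial>\<mu>) - (\<integral>x. f x \<partial>\<mu>)\<bar> \<le> 0 + e" if e: "0 < e" for e
    proof -
      \<comment> \<open>The factor \<open>(\<bar>C\<bar> + 1) * S\<close> bounds the error; the added 1 keeps the divisor positive.\<close>
      let ?K = "(\<bar>C\<bar> + 1) * S + 1"
      have K: "0 < ?K" using S by (simp add: add_nonneg_pos)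
      obtain g where g: "g \<in> bcontfun" and lt: "wnorm \<rho> (\<lambda>x. f x - g x) < e / ?K"
        using calB_obtain[OF f] e K by (metis divide_pos_pos)
      let ?h = "\<lambda>x. f x - g x"
      have gB: "g \<in> calB \<rho>" using g bcontfun_subset_calB[OF \<rho>] by blast
      have hB: "?h \<in> calB \<rho>" by (rule calB_diff_bcontfun[OF \<rho> f g])
      have n: "0 \<le> wnorm \<rho> ?h" using hB by (intro wnorm_nonneg pos) (simp add: calB_def)
      have "(\<integral>x. P s f x \<partial>\<mu>) = (\<integral>x. P s ?h x + P s g x \<partial>\<mu>)"
        using add[OF hB gB] by simp
      also have "\<dots> = (\<integral>x. P s ?h x \<partial>\<mu>) + (\<integral>x. P s g x \<partial>\<mu>)"
        by (intro Bochner_Integration.integral_add W.calB_limit_integral_bound(1) P_B s hB gB)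
      finally have 1: "(\<integral>x. P s f x \<partial>\<mu>) = (\<integral>x. P s ?h x \<partial>\<mu>) + (\<integral>x. P s g x \<partial>\<mu>)" .
      have 2: "(\<integral>x. ?h x \<partial>\<mu>) = (\<integral>x. f x \<partial>\<mu>) - (\<integral>x. g x \<partial>\<mu>)"
        by (intro Bochner_Integration.integral_diff W.calB_limit_integral_bound(1) f gB)
      have "wnorm \<rho> (P s ?h) \<le> \<bar>C\<bar> * wnorm \<rho> ?h"
        using C[OF hB] mult_right_mono[OF abs_ge_self n, of C] by linarith
      then have 3: "\<bar>\<integral>x. P s ?h x \<partial>\<mu>\<bar> \<le> \<bar>C\<bar> * wnorm \<rho> ?h * S"
        using W.calB_limit_integral_bound(2)[OF P_B[OF s hB]] mult_right_mono[OF _ S] by (meson order_trans)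
      have "\<bar>(\<integral>x. P s f x \<partial>\<mu>) - (\<integral>x. f x \<partial>\<mu>)\<bar> \<le> \<bar>C\<bar> * wnorm \<rho> ?h * S + wnorm \<rho> ?h * S"
        using 1 2 3 W.calB_limit_integral_bound(2)[OF hB] bcont[OF s g] by linarith
      also have "\<dots> \<le> ?K * wnorm \<rho> ?h" using n by (simp add: algebra_simps)
      also have "\<dots> \<le> 0 + e" using lt K by (simp add: field_simps)
      finally show ?thesis .
    qed
    then show ?thesis using field_le_epsilon[of "\<bar>(\<integral>x. P s f x \<partial>\<mu>) - (\<integral>x. f x \<partial>\<mu>)\<bar>" 0] by simp
  qed
  then show ?thesis unfolding invariant_measure_def using W.calB_limit_integral_bound(1) by blast
qed

end
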